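(* Let $N$ and $N'$ be CP-nets such that $N \rightarrow^{*}_{NBR} N'$, i.e., $N'$ is obtained from $N$ by an iterated elimination of never best responses. (i) An outcome $s$ is an optimal outcome of $N$ if and only if $s$ is an optimal outcome of $N'$ (in particular, every optimal outcome of $N$ is an outcome of $N'$). (ii) If each variable in $N'$ has a singleton domain, then the resulting (only) outcome of $N'$ is the unique optimal outcome of $N$. (iii) All iterated eliminations of never best responses from $N$ yield the same final result: if $N \rightarrow^{*}_{NBR} N_1$ and $N \rightarrow^{*}_{NBR} N_2$, and there are no $N_1', N_2'$ with $N_1\rightarrow_{NBR} N_1'$ or $N_2\rightarrow_{NBR} N_2'$, then $N_1 = N_2$.
   Context: A preference on a set $A$ is a strict linear ordering on $A$; $\succeq$ denotes the corresponding weak preference ($a \succeq b$ iff $a \succ b$ or $a=b$). **CP-nets.** A CP-net consists of variables $X_1,\ldots,X_n$ with finite non-empty domains $\mathcal{D}(X_i)$; for each $i$ a (possibly empty) set of parents $Pa(X_i) = \{X_{i_1},\ldots,X_{i_k}\} \subseteq \{X_1,\ldots,X_n\}\setminus\{X_i\}$, with index sequence $I = i_1,\ldots,i_k$; and for each $i$ and each complete assignment $a_I \in \mathcal{D}(X_{i_1})\times\cdots\times\mathcal{D}(X_{i_k})$ exactly one preference statement $X_I = a_I : \succ_i$, where $\succ_i$ (depending on $a_I$) is a preference on $\mathcal{D}(X_i)$. The dependency graph may contain cycles. An outcome is an element of $\mathcal{D}(X_1)\times\cdots\times\mathcal{D}(X_n)$. A worsening flip is a transition from an outcome $\alpha$ to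 an outcome $\beta$ that differ in the value of a single variable $X_i$, where $\alpha_i$ is preferred to $\beta_i$ in the unique preference statement for $X_i$ determined by the (common) values of $\alpha,\beta$ on $Pa(X_i)$. An outcome $\alpha$ is better than $\beta$ iff there is a chain of (one or more) worsening flips from $\alpha$ to $\beta$. An outcome is optimal if no better outcome exists. **Never best responses.** An element $d_i\in\mathcal{D}(X_i)$ is a best response to a preference statement $X_I=a_I:\succ_i$ for $X_i$ if $d_i\succeq_i d_i'$ for all $d_i'\in\mathcal{D}(X_i)$. An element $d_i\in\mathcal{D}(X_i)$ is never a best response if it is not a best response to any preference statement for $X_i$. **Subnets and reduction.** A subnet of a CP-net $N$ is a CP-net obtained from $N$ by removing some elements from some variable domains (domains remaining non-empty), keeping the same variables and parent sets, deleting the preference statements whose parent assignment $X_I=a_I$ uses a removed element, and restricting the orderings in the remaining preference statements to the remaining elements of the domains. For a CP-net $N$ and a subnet $N'$ of $N$, write $N\rightarrow_{NBR} N'$ when $N\neq N'$ and, for each variable $X_i$, each element removed from the domain of $X_i$ is never a best response in $N$. $\rightarrow^{*}_{NBR}$ is the reflexive transitive closure of $\rightarrow_{NBR}$. *)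

theory Defs
  imports Main "HOL-Library.FuncSet"
begin

definition preference_on :: "'a set \<Rightarrow> 'a rel \<Rightarrow> bool" where
  "preference_on A r \<longleftrightarrow> r \<subseteq> A \<times> A \<and> strict_linear_order_on A r"

(* The variables are the indices 1, ..., nvars, and the domains are subsets of one common type.
   A pair (d, d') in "pref N i a" means that d is preferred to d' in the preference statement
   for variable i with parent assignment a, where a is an extensional function on "parents N i". *)
record 'a cpnet =
  nvars :: nat
  vdom :: "nat \<Rightarrow> 'a set"
  parents :: "nat \<Rightarrow> nat set"
  pref :: "nat \<Rightarrow> (nat \<Rightarrow> 'a) \<Rightarrow> 'a rel"

definition vars :: "'a cpnet \<Rightarrow> nat set" where
  "vars N = {1..nvars N}"

definition outcomes :: "'a cpnet \<Rightarrow> (nat \<Rightarrow> 'a) set" where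
  "outcomes N = (\<Pi>\<^sub>E i\<in>vars N. vdom N i)"

definition parent_assignments :: "'a cpnet \<Rightarrow> nat \<Rightarrow> (nat \<Rightarrow> 'a) set" where
  "parent_assignments N i = (\<Pi>\<^sub>E j\<in>parents N i. vdom N j)"

(* The last two conjuncts fix the record fields outside their meaningful range, so that equality
   of records coincides with equality of CP-nets. *)
definition cp_net :: "'a cpnet \<Rightarrow> bool" where
  "cp_net N \<longleftrightarrow>
     (\<forall>i\<in>vars N.
        finite (vdom N i) \<and> vdom N i \<noteq> {} \<and>
        parents N i \<subseteq> vars N - {i} \<and>
        (\<forall>a\<in>parent_assignments N i. preference_on (vdom N i) (pref N i a))) \<and>
     (\<forall>i. i \<notin> vars N \<longrightarrow> vdom N i = {} \<and> parents N i = {}) \<and>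
     (\<forall>i a. i \<notin> vars N \<or> a \<notin> parent_assignments N i \<longrightarrow> pref N i a = {})"

definition worsening_flip :: "'a cpnet \<Rightarrow> (nat \<Rightarrow> 'a) \<Rightarrow> (nat \<Rightarrow> 'a) \<Rightarrow> bool" where
  "worsening_flip N \<alpha> \<beta> \<longleftrightarrow>
     \<alpha> \<in> outcomes N \<and> \<beta> \<in> outcomes N \<and>
     (\<exists>i\<in>vars N. (\<forall>j\<in>vars N - {i}. \<alpha> j = \<beta> j) \<and>
        (\<alpha> i, \<beta> i) \<in> pref N i (restrict \<alpha> (parents N i)))"

definition better :: "'a cpnet \<Rightarrow> (nat \<Rightarrow> 'a) \<Rightarrow> (nat \<Rightarrow> 'a) \<Rightarrow> bool" where
  "better N = (worsening_flip N)\<^sup>+\<^sup>+"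

definition optimal :: "'a cpnet \<Rightarrow> (nat \<Rightarrow> 'a) \<Rightarrow> bool" where
  "optimal N s \<longleftrightarrow> s \<in> outcomes N \<and> \<not> (\<exists>t\<in>outcomes N. better N t s)"

definition best_response :: "'a cpnet \<Rightarrow> nat \<Rightarrow> (nat \<Rightarrow> 'a) \<Rightarrow> 'a \<Rightarrow> bool" where
  "best_response N i a d \<longleftrightarrow>
     d \<in> vdom N i \<and> (\<forall>d'\<in>vdom N i. (d, d') \<in> pref N i a \<or> d = d')"

definition never_best_response :: "'a cpnet \<Rightarrow> nat \<Rightarrow> 'a \<Rightarrow> bool" where
  "never_best_response N i d \<longleftrightarrow>
     d \<in> vdom N i \<and> \<not> (\<exists>a\<in>parent_assignments N i. best_response N i a d)"

definition subnet :: "'a cpnet \<Rightarrow> 'a cpnet \<Rightarrow> bool" where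
  "subnet N' N \<longleftrightarrow>
     cp_net N' \<and> nvars N' = nvars N \<and>
     (\<forall>i\<in>vars N. parents N' i = parents N i \<and> vdom N' i \<subseteq> vdom N i \<and>
        (\<forall>a\<in>parent_assignments N' i.
           pref N' i a = pref N i a \<inter> (vdom N' i \<times> vdom N' i)))"

definition nbr_step :: "'a cpnet \<Rightarrow> 'a cpnet \<Rightarrow> bool" where
  "nbr_step N N' \<longleftrightarrow>
     subnet N' N \<and> N \<noteq> N' \<and>
     (\<forall>i\<in>vars N. \<forall>d\<in>vdom N i - vdom N' i. never_best_response N i d)"

end

(* An outcome is optimal iff each of its coordinates is a best response to its parent values,
   because any improving chain into it ends with a flip of a single variable.  Eliminating never
   best responses keeps the best response to every surviving parent assignment, so "being a best
   response" does not change along an elimination sequence; this gives (i) and (ii).  For (iii),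
   let N2 be a final result and suppose that some step from M to M' of another sequence is the first to
   remove an element d of N2.  Then d is not a best response in M, hence not one in N2, which has
   fewer parent assignments, so N2 could be reduced further.  Thus two final results have the same
   domains. *)
theory Submission
  imports Defs
begin

section \<open>Preference statements and their best responses\<close>

lemma cp_net_pref:
  assumes "cp_net N" "i \<in> vars N" "a \<in> parent_assignments N i"
  shows "pref N i a \<subseteq> vdom N i \<times> vdom N i"
    and "trans (pref N i a)" and "irrefl (pref N i a)" and "total_on (vdom N i) (pref N i a)"
  using assms unfolding cp_net_def preference_on_def strict_linear_order_on_def by auto

lemma cp_net_vdom:
  assumes "cp_net N" "i \<in> vars N"
  shows "finite (vdom N i)" and "vdom N i \<noteq> {}" and "parents N i \<subseteq> vars N - {i}"
  using assms unfolding cp_net_def by auto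

lemma cp_net_outside:
  assumes "cp_net N"
  shows "i \<notin> vars N \<Longrightarrow> vdom N i = {}" and "i \<notin> vars N \<Longrightarrow> parents N i = {}"
    and "i \<notin> vars N \<Longrightarrow> pref N i a = {}" and "a \<notin> parent_assignments N i \<Longrightarrow> pref N i a = {}"
  using assms unfolding cp_net_def by auto

text \<open>A finite non-empty strict linear order has a top element. This is the only use of
  finiteness in the argument, and it is what keeps domains non-empty when never best responses are
  deleted.\<close>

lemma best_response_exists:
  assumes "cp_net N" "i \<in> vars N" "a \<in> parent_assignments N i"
  shows "\<exists>d. best_response N i a d"
proof -
  note p = cp_net_pref[OF assms]
  have "\<exists>m\<in>B. \<forall>d\<in>B. (m, d) \<in> pref N i a \<or> m = d"
    if "finite B" "B \<noteq> {}" "B \<subseteq> vdom N i" for B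
    using that
  proof (induction B rule: finite_ne_induct)
    case (singleton x)
    then show ?case by simp
  next
    case (insert x F)
    then obtain m where m: "m \<in> F" "\<forall>d\<in>F. (m, d) \<in> pref N i a \<or> m = d" by auto
    \<comment> \<open>The new element is compared only with the old maximum \<open>m\<close>; if it
      wins, transitivity places it above all of \<open>F\<close>.\<close>
    have "(x, m) \<in> pref N i a \<or> (m, x) \<in> pref N i a \<or> x = m"
      using p(4) m(1) insert.prems unfolding total_on_def by blast
    then show ?case
      using m transD[OF p(2), of x m] by auto
  qed
  then show ?thesis
    using cp_net_vdom[OF assms(1,2)] unfolding best_response_def by blast
qed

lemma best_response_unique:
  assumes "cp_net N" "i \<in> vars N" "a \<in> parent_assignments N i"
    and "best_response N i a d" "best_response N i a e"
  shows "d = e"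
proof (rule ccontr)
  assume "d \<noteq> e"
  then have "(d, e) \<in> pref N i a" "(e, d) \<in> pref N i a"
    using assms(4,5) unfolding best_response_def by auto
  then show False
    using cp_net_pref(2,3)[OF assms(1-3)] by (meson irreflD transD)
qed

section \<open>Optimality as a condition on single coordinates\<close>

lemma restrict_parents_in_parent_assignments:
  assumes "cp_net N" "i \<in> vars N" "s \<in> outcomes N"
  shows "restrict s (parents N i) \<in> parent_assignments N i"
  using assms cp_net_vdom(3)[OF assms(1,2)]
  unfolding outcomes_def parent_assignments_def by (fastforce simp: PiE_iff)

lemma optimal_iff_no_flip:
  "optimal N s \<longleftrightarrow> s \<in> outcomes N \<and> (\<nexists>t. worsening_flip N t s)"
proof -
  have "\<exists>u. worsening_flip N u s" if "better N t s" for t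
    using that unfolding better_def by (auto elim: tranclp.cases)
  moreover have "better N t s" "t \<in> outcomes N" if "worsening_flip N t s" for t
    using that unfolding better_def by (blast, simp add: worsening_flip_def)
  ultimately show ?thesis unfolding optimal_def by blast
qed

text \<open>A variable is never its own parent, so flipping it leaves its preference statement
  unchanged. The flips into \<open>s\<close> at variable \<open>i\<close> therefore correspond to
  the values preferred to \<open>s i\<close> in one fixed linear order.\<close>

lemma optimal_iff_best_response:
  assumes "cp_net N"
  shows "optimal N s \<longleftrightarrow> s \<in> outcomes N \<and>
    (\<forall>i\<in>vars N. best_response N i (restrict s (parents N i)) (s i))"
proof (cases "s \<in> outcomes N")
  case s: True
  have flip_iff: "(\<exists>t. worsening_flip N t s) \<longleftrightarrow>
      (\<exists>i\<in>vars N. \<exists>d\<in>vdom N i. (d, s i) \<in> pref N i (restrict s (parents N i)))"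
  proof
    assume "\<exists>t. worsening_flip N t s"
    then obtain t i where t: "t \<in> outcomes N" "i \<in> vars N" "\<forall>j\<in>vars N - {i}. t j = s j"
      "(t i, s i) \<in> pref N i (restrict t (parents N i))"
      unfolding worsening_flip_def by blast
    have "restrict t (parents N i) = restrict s (parents N i)"
      using t(3) cp_net_vdom(3)[OF assms t(2)] by (intro restrict_ext) blast
    with t show "\<exists>i\<in>vars N. \<exists>d\<in>vdom N i. (d, s i) \<in> pref N i (restrict s (parents N i))"
      unfolding outcomes_def by (auto simp: PiE_iff)
  next
    assume "\<exists>i\<in>vars N. \<exists>d\<in>vdom N i. (d, s i) \<in> pref N i (restrict s (parents N i))"
    then obtain i d where d: "i \<in> vars N" "d \<in> vdom N i"
      "(d, s i) \<in> pref N i (restrict s (parents N i))" by blast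
    have "restrict (s(i := d)) (parents N i) = restrict s (parents N i)"
      using cp_net_vdom(3)[OF assms d(1)] by (intro restrict_ext) auto
    moreover have "s(i := d) \<in> outcomes N"
      using s d unfolding outcomes_def by (auto simp: PiE_iff extensional_def)
    ultimately have "worsening_flip N (s(i := d)) s"
      using s d unfolding worsening_flip_def by (auto intro!: bexI[of _ i])
    then show "\<exists>t. worsening_flip N t s" by blast
  qed
  \<comment> \<open>Totality turns the absence of a preferred value into a best response;
    irreflexivity and transitivity give the converse.\<close>
  have "best_response N i (restrict s (parents N i)) (s i) \<longleftrightarrow>
      \<not> (\<exists>d\<in>vdom N i. (d, s i) \<in> pref N i (restrict s (parents N i)))" if i: "i \<in> vars N" for i
  proof -
    note p = cp_net_pref[OF assms i restrict_parents_in_parent_assignments[OF assms i s]]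
    have "s i \<in> vdom N i" using s i unfolding outcomes_def by auto
    then show ?thesis
      using p(2-4) unfolding best_response_def trans_def irrefl_def total_on_def by blast
  qed
  with s flip_iff show ?thesis by (auto simp: optimal_iff_no_flip)
qed (simp add: optimal_def)

section \<open>Subnets, and what determines them\<close>

lemma vars_subnet: "subnet M N \<Longrightarrow> vars M = vars N"
  unfolding subnet_def vars_def by simp

lemma subnetD:
  assumes "subnet M N" "i \<in> vars N"
  shows "parents M i = parents N i" and "vdom M i \<subseteq> vdom N i"
    and "a \<in> parent_assignments M i \<Longrightarrow> pref M i a = pref N i a \<inter> (vdom M i \<times> vdom M i)"
  using assms unfolding subnet_def by auto

text \<open>Assumes inclusion of domains instead of \<open>subnet\<close>, because the confluence
  argument compares two nets reached from \<open>N\<close> by different eliminations.\<close>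

lemma parent_assignments_mono:
  assumes "cp_net N" "i \<in> vars N" "parents M i = parents N i"
    and "\<And>j. j \<in> vars N \<Longrightarrow> vdom M j \<subseteq> vdom N j"
  shows "parent_assignments M i \<subseteq> parent_assignments N i"
  using assms(3,4) cp_net_vdom(3)[OF assms(1,2)]
  unfolding parent_assignments_def by (auto intro!: PiE_mono)

lemma parent_assignments_subnet:
  assumes "cp_net N" "subnet M N" "i \<in> vars N"
  shows "parent_assignments M i \<subseteq> parent_assignments N i"
  using parent_assignments_mono assms subnetD(1,2)[OF assms(2)] by metis

lemma subnet_refl: "cp_net N \<Longrightarrow> subnet N N"
  unfolding subnet_def using cp_net_pref(1) by (auto simp: Int_absorb2)

lemma subnet_trans:
  assumes "cp_net N" "subnet M N" "subnet L M"
  shows "subnet L N"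
proof -
  have M: "cp_net M" using assms(2) unfolding subnet_def by simp
  have v: "vars M = vars N" using assms(2) by (rule vars_subnet)
  show ?thesis
    unfolding subnet_def
  proof (intro conjI ballI)
    show "cp_net L" "nvars L = nvars N" using assms(2,3) unfolding subnet_def by auto
    fix i assume i: "i \<in> vars N"
    note m = subnetD[OF assms(2) i] and l = subnetD[OF assms(3), unfolded v, OF i]
    show "parents L i = parents N i" "vdom L i \<subseteq> vdom N i" using m l by auto
    fix a assume a: "a \<in> parent_assignments L i"
    then have "a \<in> parent_assignments M i"
      using parent_assignments_subnet[OF M assms(3)] i v by auto
    then show "pref L i a = pref N i a \<inter> (vdom L i \<times> vdom L i)"
      using a m l by auto
  qed
qed

text \<open>Parents and orders are inherited from \<open>N\<close>, and \<open>cp_net\<close> fixes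
  all fields outside their meaningful range, so only the domains can distinguish two
  subnets.\<close>

lemma subnet_eqI:
  assumes "subnet L N" "subnet M N" "\<And>i. i \<in> vars N \<Longrightarrow> vdom L i = vdom M i"
  shows "L = M"
proof -
  have c: "cp_net L" "cp_net M" "nvars L = nvars M"
    using assms(1,2) unfolding subnet_def by auto
  have v: "vars L = vars N" "vars M = vars N" using assms(1,2) by (auto dest: vars_subnet)
  have d: "vdom L = vdom M"
  proof
    fix i show "vdom L i = vdom M i"
      using cp_net_outside(1)[OF c(1)] cp_net_outside(1)[OF c(2)] v assms(3)
      by (cases "i \<in> vars N") auto
  qed
  have p: "parents L = parents M"
  proof
    fix i show "parents L i = parents M i"
      using cp_net_outside(2)[OF c(1)] cp_net_outside(2)[OF c(2)] v
        subnetD(1)[OF assms(1)] subnetD(1)[OF assms(2)]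
      by (cases "i \<in> vars N") auto
  qed
  have pa: "parent_assignments L = parent_assignments M"
    unfolding parent_assignments_def d p ..
  have "pref L i a = pref M i a" for i a
  proof (cases "i \<in> vars N \<and> a \<in> parent_assignments M i")
    case True
    then show ?thesis
      using subnetD(3)[OF assms(1), of i a] subnetD(3)[OF assms(2), of i a] d pa by simp
  next
    case False
    then show ?thesis
      using cp_net_outside(3,4)[OF c(1)] cp_net_outside(3,4)[OF c(2)] v pa by auto
  qed
  with c d p show ?thesis by (intro cpnet.equality ext) auto
qed

section \<open>Invariance of best responses and optimal outcomes under elimination\<close>

lemma nbr_step_best_response_iff:
  assumes N: "cp_net N" and st: "nbr_step N M" and i: "i \<in> vars N"
    and a: "a \<in> parent_assignments M i"
  shows "best_response M i a d \<longleftrightarrow> best_response N i a d"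
proof -
  have sub: "subnet M N" using st unfolding nbr_step_def by simp
  have M: "cp_net M" using sub unfolding subnet_def by simp
  have aN: "a \<in> parent_assignments N i" using parent_assignments_subnet[OF N sub i] a by blast
  \<comment> \<open>The statement for \<open>a\<close> itself witnesses that \<open>e\<close> is not
    a never best response, so \<open>e\<close> survives, and it still beats the remaining
    values.\<close>
  have down: "best_response M i a e" if e: "best_response N i a e" for e
  proof -
    have "e \<in> vdom M i"
      using st i e aN unfolding nbr_step_def never_best_response_def best_response_def by blast
    then show ?thesis
      using e subnetD(2,3)[OF sub i] a unfolding best_response_def by auto
  qed
  \<comment> \<open>For the other direction, the best response in \<open>N\<close> passes down to
    \<open>M\<close>, where uniqueness identifies it with any best response of
    \<open>M\<close>.\<close>
  obtain e where "best_response N i a e" using best_response_exists[OF N i aN] by blast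
  then show ?thesis
    using down best_response_unique[OF M _ a] i vars_subnet[OF sub] by metis
qed

lemma nbr_step_optimal_iff:
  assumes N: "cp_net N" and st: "nbr_step N M"
  shows "optimal N s \<longleftrightarrow> optimal M s"
proof -
  have sub: "subnet M N" using st unfolding nbr_step_def by simp
  have M: "cp_net M" using sub unfolding subnet_def by simp
  have v: "vars M = vars N" using sub by (rule vars_subnet)
  have le: "outcomes M \<subseteq> outcomes N"
    using subnetD(2)[OF sub] v unfolding outcomes_def by (auto intro!: PiE_mono)
  \<comment> \<open>Every coordinate of an optimal outcome is a best response to its own parent
    values, so none of them can be eliminated.\<close>
  have keep: "s \<in> outcomes M" if "optimal N s"
  proof -
    have s: "s \<in> outcomes N"
      and br: "\<And>i. i \<in> vars N \<Longrightarrow> best_response N i (restrict s (parents N i)) (s i)"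
      using that optimal_iff_best_response[OF N] by auto
    have "s i \<in> vdom M i" if i: "i \<in> vars N" for i
      using st i br[OF i] restrict_parents_in_parent_assignments[OF N i s]
      unfolding nbr_step_def never_best_response_def best_response_def by blast
    with s show ?thesis unfolding outcomes_def v by (auto simp: PiE_iff)
  qed
  have "best_response M i (restrict s (parents M i)) (s i) \<longleftrightarrow>
      best_response N i (restrict s (parents N i)) (s i)"
    if "s \<in> outcomes M" "i \<in> vars N" for i
    using nbr_step_best_response_iff[OF N st that(2)
        restrict_parents_in_parent_assignments[OF M that(2)[folded v] that(1)]]
      subnetD(1)[OF sub that(2)]
    by simp
  then show ?thesis
    using keep le v by (auto simp: optimal_iff_best_response[OF N] optimal_iff_best_response[OF M])
qed

lemma nbr_steps_subnet:
  assumes "cp_net N" "nbr_step\<^sup>*\<^sup>* N M"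
  shows "subnet M N"
  using assms(2)
proof induction
  case base
  show ?case by (rule subnet_refl[OF assms(1)])
next
  case (step M L)
  then show ?case using subnet_trans[OF assms(1)] unfolding nbr_step_def by blast
qed

lemma nbr_steps_optimal_iff:
  assumes "cp_net N" "nbr_step\<^sup>*\<^sup>* N M"
  shows "optimal N s \<longleftrightarrow> optimal M s"
  using assms(2)
proof induction
  case (step M L)
  then show ?case
    using nbr_step_optimal_iff nbr_steps_subnet[OF assms(1)] unfolding subnet_def by blast
qed simp

lemma nbr_steps_best_response_iff:
  assumes "cp_net N" "nbr_step\<^sup>*\<^sup>* N M" "i \<in> vars N" "a \<in> parent_assignments M i"
  shows "best_response M i a d \<longleftrightarrow> best_response N i a d"
  using assms(2,4)
proof induction
  case (step M L)
  have M: "subnet M N" "cp_net M" "i \<in> vars M"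
    using nbr_steps_subnet[OF assms(1) step.hyps(1)] assms(3)
    unfolding subnet_def vars_def by auto
  have "a \<in> parent_assignments M i"
    using step.prems parent_assignments_subnet[OF M(2) _ M(3)] step.hyps(2)
    unfolding nbr_step_def by blast
  then show ?case
    using step.IH nbr_step_best_response_iff[OF M(2) step.hyps(2) M(3) step.prems] by simp
qed simp

section \<open>Confluence: all final results have the same domains\<close>

lemma ex_nbr_step:
  assumes N: "cp_net N" and i: "i \<in> vars N" and d: "never_best_response N i d"
  shows "\<exists>M. nbr_step N M"
proof -
  define D where "D = (vdom N)(i := vdom N i - {d})"
  \<comment> \<open>\<open>P\<close> anticipates the parent assignments of \<open>M\<close>, so that
    the orders of deleted statements can be set to the default \<open>{}\<close> demanded by
    \<open>cp_net\<close>.\<close>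
  define P where "P = (\<lambda>k. \<Pi>\<^sub>E j\<in>parents N k. D j)"
  define M where "M = N\<lparr>vdom := D,
    pref := \<lambda>k a. if a \<in> P k then pref N k a \<inter> (D k \<times> D k) else {}\<rparr>"
  have v: "vars M = vars N" unfolding vars_def M_def by simp
  have P: "parent_assignments M k = P k" for k
    unfolding parent_assignments_def P_def M_def by simp
  have DN: "D k \<subseteq> vdom N k" for k unfolding D_def by auto
  have PN: "P k \<subseteq> parent_assignments N k" for k
    unfolding P_def parent_assignments_def using DN by (intro PiE_mono)
  \<comment> \<open>At least one statement for \<open>i\<close> exists. Its best response differs
    from \<open>d\<close>, so deleting \<open>d\<close> leaves the domain of \<open>i\<close>
    non-empty.\<close>
  have "parent_assignments N i \<noteq> {}"
    using cp_net_vdom[OF N] i unfolding parent_assignments_def PiE_eq_empty_iff by blast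
  then obtain e a where "a \<in> parent_assignments N i" "best_response N i a e"
    using best_response_exists[OF N i] by blast
  then have "e \<in> vdom N i" "e \<noteq> d"
    using d unfolding never_best_response_def best_response_def by auto
  then have ne: "D k \<noteq> {}" if "k \<in> vars N" for k
    using cp_net_vdom(2)[OF N that] unfolding D_def by auto
  have "preference_on (D k) (pref M k a)" if "k \<in> vars N" "a \<in> P k" for k a
  proof -
    note p = cp_net_pref[OF N that(1) subsetD[OF PN that(2)]]
    have "pref M k a = pref N k a \<inter> (D k \<times> D k)" using that unfolding M_def by simp
    moreover have "trans (pref N k a \<inter> (D k \<times> D k))"
      using p(2) by (auto intro!: transI dest: transD)
    moreover have "irrefl (pref N k a \<inter> (D k \<times> D k))"
      using p(3) unfolding irrefl_def by blast
    moreover have "total_on (D k) (pref N k a \<inter> (D k \<times> D k))"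
      using p(4) subsetD[OF DN[of k]] unfolding total_on_def by auto
    ultimately show ?thesis
      unfolding preference_on_def strict_linear_order_on_def by simp
  qed
  moreover have "vdom M = D" "parents M = parents N" unfolding M_def by auto
  moreover have "pref M k a = {}" if "k \<notin> vars N \<or> a \<notin> P k" for k a
    using that cp_net_outside(3)[OF N] unfolding M_def by auto
  moreover have "finite (D k)" if "k \<in> vars N" for k
    using cp_net_vdom(1)[OF N that] DN finite_subset by blast
  moreover have "D k = {}" if "k \<notin> vars N" for k
    using cp_net_outside(1)[OF N that] DN by blast
  ultimately have "cp_net M"
    using N ne unfolding cp_net_def v P by simp
  then have "subnet M N"
    using DN P unfolding subnet_def M_def by auto
  moreover have "N \<noteq> M"
  proof
    assume "N = M"
    then have "vdom N i = vdom M i" by simp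
    also have "\<dots> = D i" unfolding M_def by simp
    finally have "vdom N i = D i" .
    then show False using d unfolding D_def never_best_response_def by auto
  qed
  moreover have "never_best_response N k x" if "x \<in> vdom N k - vdom M k" for k x
    using that d unfolding M_def D_def by (auto split: if_splits)
  ultimately show ?thesis unfolding nbr_step_def by blast
qed

text \<open>By induction along the elimination leading to \<open>M\<close>. The variable must stay
  arbitrary, since the step for \<open>i\<close> uses the inclusion for the domains of its
  parents.\<close>

lemma nbr_final_vdom_subset:
  assumes N: "cp_net N" and K: "nbr_step\<^sup>*\<^sup>* N K" and final: "\<nexists>K'. nbr_step K K'"
    and M: "nbr_step\<^sup>*\<^sup>* N M" and i: "i \<in> vars N"
  shows "vdom K i \<subseteq> vdom M i"
  using M i
proof (induction arbitrary: i)
  case base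
  then show ?case using subnetD(2) nbr_steps_subnet[OF N K] by blast
next
  case (step M L)
  have subK: "subnet K N" and subM: "subnet M N"
    using nbr_steps_subnet[OF N] K step.hyps(1) by auto
  have cK: "cp_net K" and cM: "cp_net M" and v: "vars K = vars N" "vars M = vars N"
    using subK subM vars_subnet unfolding subnet_def by auto
  have par: "parents K i = parents M i" using subnetD(1) subK subM step.prems by metis
  show ?case
  proof
    fix d assume d: "d \<in> vdom K i"
    show "d \<in> vdom L i"
    proof (rule ccontr)
      assume "d \<notin> vdom L i"
      then have "never_best_response M i d"
        using step d v unfolding nbr_step_def by blast
      moreover have "parent_assignments K i \<subseteq> parent_assignments M i"
        using parent_assignments_mono[OF cM _ par] step.IH step.prems v by simp
      \<comment> \<open>On parent assignments of \<open>K\<close>, both \<open>K\<close> and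
        \<open>M\<close> have the best responses of \<open>N\<close>; a statement of
        \<open>K\<close> with best response \<open>d\<close> would thus be one of \<open>M\<close>
        too.\<close>
      ultimately have "never_best_response K i d"
        using d nbr_steps_best_response_iff[OF N K step.prems]
          nbr_steps_best_response_iff[OF N step.hyps(1) step.prems]
        unfolding never_best_response_def by blast
      then show False using ex_nbr_step[OF cK] final step.prems v by blast
    qed
  qed
qed

theorem theorem4:
  fixes N N' :: "'a cpnet"
  assumes "cp_net N" and "cp_net N'"
    and "nbr_step\<^sup>*\<^sup>* N N'"
  shows "(\<forall>s. (optimal N s \<longleftrightarrow> optimal N' s) \<and> (optimal N s \<longrightarrow> s \<in> outcomes N')) \<and>
    ((\<forall>i\<in>vars N'. \<exists>d. vdom N' i = {d}) \<longrightarrow>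
       (\<exists>s. outcomes N' = {s} \<and> optimal N s \<and> (\<forall>t. optimal N t \<longrightarrow> t = s))) \<and>
    (\<forall>N\<^sub>1 N\<^sub>2. nbr_step\<^sup>*\<^sup>* N N\<^sub>1 \<and> nbr_step\<^sup>*\<^sup>* N N\<^sub>2 \<and>
       \<not> (\<exists>N\<^sub>1'. nbr_step N\<^sub>1 N\<^sub>1') \<and> \<not> (\<exists>N\<^sub>2'. nbr_step N\<^sub>2 N\<^sub>2') \<longrightarrow> N\<^sub>1 = N\<^sub>2)"
proof (intro conjI allI impI)
  note opt = nbr_steps_optimal_iff[OF assms(1,3)]
  fix s
  show "optimal N s \<longleftrightarrow> optimal N' s" by (rule opt)
  show "s \<in> outcomes N'" if "optimal N s" using that opt unfolding optimal_def by blast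
next
  assume "\<forall>i\<in>vars N'. \<exists>d. vdom N' i = {d}"
  then obtain f where f: "\<And>i. i \<in> vars N' \<Longrightarrow> vdom N' i = {f i}" by metis
  define s where "s = restrict f (vars N')"
  have out: "outcomes N' = {s}"
  proof -
    have "outcomes N' = (\<Pi>\<^sub>E i\<in>vars N'. {s i})"
      unfolding outcomes_def s_def using f by (intro PiE_cong) simp
    also have "\<dots> = {s}" unfolding s_def by (intro PiE_singleton restrict_extensional)
    finally show ?thesis .
  qed
  \<comment> \<open>In a singleton domain the equality case of \<open>best_response\<close> makes
    the only value a best response.\<close>
  have "best_response N' i (restrict s (parents N' i)) (s i)" if "i \<in> vars N'" for i
    using f that unfolding best_response_def s_def by auto
  then have "optimal N' s"
    using out optimal_iff_best_response[OF assms(2)] by blast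
  moreover have "t = s" if "optimal N' t" for t
    using that out unfolding optimal_def by simp
  ultimately show "\<exists>s. outcomes N' = {s} \<and> optimal N s \<and> (\<forall>t. optimal N t \<longrightarrow> t = s)"
    using out nbr_steps_optimal_iff[OF assms(1,3)] by blast
next
  fix N\<^sub>1 N\<^sub>2
  assume "nbr_step\<^sup>*\<^sup>* N N\<^sub>1 \<and> nbr_step\<^sup>*\<^sup>* N N\<^sub>2 \<and>
    \<not> (\<exists>N\<^sub>1'. nbr_step N\<^sub>1 N\<^sub>1') \<and> \<not> (\<exists>N\<^sub>2'. nbr_step N\<^sub>2 N\<^sub>2')"
  then have steps: "nbr_step\<^sup>*\<^sup>* N N\<^sub>1" "nbr_step\<^sup>*\<^sup>* N N\<^sub>2"
    and final: "\<nexists>K. nbr_step N\<^sub>1 K" "\<nexists>K. nbr_step N\<^sub>2 K"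
    by blast+
  show "N\<^sub>1 = N\<^sub>2"
  proof (rule subnet_eqI)
    show "subnet N\<^sub>1 N" "subnet N\<^sub>2 N"
      by (intro nbr_steps_subnet[OF assms(1)] steps)+
    \<comment> \<open>Each of the two nets serves once as the final one, giving both
      inclusions.\<close>
    show "vdom N\<^sub>1 i = vdom N\<^sub>2 i" if "i \<in> vars N" for i
      by (intro subset_antisym nbr_final_vdom_subset[OF assms(1)] steps final that)
  qed
qed

end
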